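(* For every $n\ge2$, the caracol graph $\mathrm{Car}_{n+1}$ satisfies $$\operatorname{vol}\mathcal{F}_{\mathrm{Car}_{n+1}}(1,1,0,\ldots,0)=C_{n-2}\cdot n\cdot 2^{n-3},$$ where $(1,1,0,\ldots,0)\in\mathbb{Z}^n$ and $C_k=\frac{1}{k+1}\binom{2k}{k}$.
   Context: The caracol graph $\mathrm{Car}_{n+1}$ is the directed graph on $\{1,\ldots,n+1\}$ with edges $(1,j)$ for $2\le j\le n$, $(i,i+1)$ for $2\le i\le n$, and $(i,n+1)$ for $2\le i\le n-1$ (so $m=3n-4$ edges). For a connected directed graph $G$ on $[n+1]$ with $m$ edges, each directed from smaller to larger vertex, and $\mathbf{a}\in\mathbb{Z}^n$, the flow polytope $\mathcal{F}_G(\mathbf{a})\subset\mathbb{R}^m$ is the set of tuples $(b_e)_{e\in E(G)}$ of nonnegative reals such that for each $j=1,\ldots,n$, (sum of $b_e$ over edges leaving $j$) minus (sum of $b_e$ over edges entering $j$) equals $a_j$. It lies in an affine subspace of dimension $m-n$, and $\operatorname{vol}$ is normalized volume: $(m-n)!$ times the $(m-n)$-dimensional volume, normalized so that a fundamental cell of the lattice of integer points of the linear subspace parallel to this affine subspace has volume $1$. *)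

theory Defs
  imports "HOL-Analysis.Analysis" "Graph_Theory.Digraph"
begin

section \<open>The caracol graph\<close>

text \<open>\<^term>\<open>caracol n\<close> is the graph $\mathrm{Car}_{n+1}$ on the $n+1$ vertices $1,\ldots,n+1$.\<close>

definition caracol :: "nat \<Rightarrow> (nat, nat \<times> nat) pre_digraph" where
  "caracol n =
    \<lparr> verts = {1..n+1},
      arcs = {(1, j) | j. 2 \<le> j \<and> j \<le> n}
           \<union> {(i, i+1) | i. 2 \<le> i \<and> i \<le> n}
           \<union> {(i, n+1) | i. 2 \<le> i \<and> i \<le> n-1},
      tail = fst, head = snd \<rparr>"

lemma caracol_arcs_increasing:
  "e \<in> arcs (caracol n) \<Longrightarrow> tail (caracol n) e < head (caracol n) e"
  by (auto simp: caracol_def)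

lemma wf_digraph_caracol: "wf_digraph (caracol n)"
  by unfold_locales (auto simp: caracol_def)

lemma card_arcs_caracol:
  assumes "n \<ge> 2"
  shows "card (arcs (caracol n)) = 3 * n - 4"
proof -
  have arcs: "arcs (caracol n) =
    Pair 1 ` {2..n} \<union> ((\<lambda>i. (i, i+1)) ` {2..n} \<union> (\<lambda>i. (i, n+1)) ` {2..n-1})"
    by (auto simp: caracol_def)
  have c1: "card (Pair (1::nat) ` {2..n}) = n - 1"
    by (subst card_image) (auto simp: inj_on_def)
  have c2: "card ((\<lambda>i. (i, i+1)) ` {2..n}) = n - 1"
    by (subst card_image) (auto simp: inj_on_def)
  have c3: "card ((\<lambda>i. (i, n+1)) ` {2..n-1}) = n - 2"
    by (subst card_image) (auto simp: inj_on_def)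
  have "card ((\<lambda>i. (i, i+1)) ` {2..n} \<union> (\<lambda>i. (i, n+1)) ` {2..n-1}) = (n - 1) + (n - 2)"
    by (subst card_Un_disjoint) (use c2 c3 in auto)
  then show ?thesis
    unfolding arcs using assms c1 by (subst card_Un_disjoint) auto
qed


section \<open>Flow polytopes\<close>

text \<open>
  In this section the digraph \<^term>\<open>G\<close> has vertex set $\{1,\ldots,n+1\}$, and netflows
  $(a_1,\ldots,a_n)$ are given by the values of a function at $1,\ldots,n$; its other values are
  irrelevant.  The space $\mathbb{R}^{E(G)}$ is represented by the real functions on the type of
  arcs that vanish outside \<^term>\<open>arcs G\<close>.
\<close>

definition netflow :: "(nat, 'e) pre_digraph \<Rightarrow> ('e \<Rightarrow> real) \<Rightarrow> nat \<Rightarrow> real" where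
  "netflow G b j = (\<Sum>e\<in>out_arcs G j. b e) - (\<Sum>e\<in>in_arcs G j. b e)"

definition flow_space :: "(nat, 'e) pre_digraph \<Rightarrow> nat \<Rightarrow> (nat \<Rightarrow> int) \<Rightarrow> ('e \<Rightarrow> real) set" where
  "flow_space G n a =
    {b. (\<forall>e. e \<notin> arcs G \<longrightarrow> b e = 0) \<and> (\<forall>j\<in>{1..n}. netflow G b j = of_int (a j))}"

definition flow_polytope :: "(nat, 'e) pre_digraph \<Rightarrow> nat \<Rightarrow> (nat \<Rightarrow> int) \<Rightarrow> ('e \<Rightarrow> real) set" where
  "flow_polytope G n a = {b \<in> flow_space G n a. \<forall>e\<in>arcs G. 0 \<le> b e}"

text \<open>The integer points of the linear subspace parallel to the flow spaces
  \<^term>\<open>flow_space G n a\<close>.\<close>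

definition flow_lattice :: "(nat, 'e) pre_digraph \<Rightarrow> nat \<Rightarrow> ('e \<Rightarrow> real) set" where
  "flow_lattice G n = {b \<in> flow_space G n (\<lambda>_. 0). \<forall>e. b e \<in> \<int>}"


section \<open>Volume relative to a lattice\<close>

text \<open>The family $B_0,\ldots,B_{d-1}$ is a basis of the lattice \<^term>\<open>L\<close>.\<close>

definition lattice_basis :: "nat \<Rightarrow> (nat \<Rightarrow> 'e \<Rightarrow> real) \<Rightarrow> ('e \<Rightarrow> real) set \<Rightarrow> bool" where
  "lattice_basis d B L \<longleftrightarrow>
    (\<forall>t :: nat \<Rightarrow> real. (\<forall>e. (\<Sum>i<d. t i * B i e) = 0) \<longrightarrow> (\<forall>i<d. t i = 0)) \<and>
    L = {(\<lambda>e. \<Sum>i<d. of_int (c i) * B i e) | c :: nat \<Rightarrow> int. True}"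

text \<open>
  Let \<^term>\<open>A\<close> be an affine space whose parallel linear space is spanned by the lattice
  \<^term>\<open>L\<close> of rank \<^term>\<open>d\<close>.  Every point \<^term>\<open>p\<close> of \<^term>\<open>A\<close> and every basis of
  \<^term>\<open>L\<close> give coordinates on \<^term>\<open>A\<close> that map a fundamental cell of \<^term>\<open>L\<close> to the unit cube.
  The volume of \<^term>\<open>S\<close> is the $d$-dimensional Lebesgue measure in these coordinates.  It depends
  neither on the basis (base changes are unimodular) nor on the point, which is what makes the
  definite description below denote.
\<close>

definition lattice_volume ::
    "nat \<Rightarrow> ('e \<Rightarrow> real) set \<Rightarrow> ('e \<Rightarrow> real) set \<Rightarrow> ('e \<Rightarrow> real) set \<Rightarrow> real" where
  "lattice_volume d L A S =
    (THE v. \<exists>B p. lattice_basis d B L \<and> p \<in> A \<and>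
      v = measure (\<Pi>\<^sub>M i\<in>{..<d}. lborel)
            {t \<in> space (\<Pi>\<^sub>M i\<in>{..<d}. lborel). (\<lambda>e. p e + (\<Sum>i<d. t i * B i e)) \<in> S})"

definition flow_polytope_volume :: "(nat, 'e) pre_digraph \<Rightarrow> nat \<Rightarrow> (nat \<Rightarrow> int) \<Rightarrow> real" where
  "flow_polytope_volume G n a =
    (let d = card (arcs G) - n
     in fact d * lattice_volume d (flow_lattice G n) (flow_space G n a) (flow_polytope G n a))"


definition catalan :: "nat \<Rightarrow> real" where
  "catalan k = 1 / (real k + 1) * real ((2 * k) choose k)"

end

theory Submission
  imports Defs
begin

text \<open>
  Put $k = n-2$. A flow on $\mathrm{Car}_{n+1}$ is determined by $x_j = b_{(1,j)}$ and
  $y_j = b_{(j,j+1)}$ for $2 \le j \le n-1$, and these coordinates are integral in both directions. In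
  them the polytope is given by $x_j \ge 0$, $\sum_j x_j \le 1$ and $0 \le y_j \le y_{j-1} + x_j$, where
  $y_1 = 1$. Let $V_k(s,y)$ be the volume of the same region with $1$ replaced by $s$ in the bound on
  the sum and by $y$ in the value of $y_1$. Splitting off the first pair of coordinates gives
  \[ V_{k+1}(s,y) = \int_0^s \int_0^{y+x} V_k(s-x,y')\,dy'\,dx, \]
  and induction shows
  $V_k(s,y) = \frac{s^k}{k!\,(k+1)!}\,\frac{\partial}{\partial y}\bigl(y(s+y)^k\bigr)$. The result is
  $(2k)!\,V_k(1,1)$.

  The volume does not depend on the chosen lattice basis because a linear bijection of
  $\mathbb{Z}^d$ preserves Lebesgue measure: up to a factor this is the uniqueness of Haar measure,
  and the factor is 1 because the unit cube and its preimage are both fundamental domains of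
  $\mathbb{Z}^d$.
\<close>

section \<open>Unimodular maps preserve Lebesgue measure\<close>

abbreviation lborel_pow :: "nat \<Rightarrow> (nat \<Rightarrow> real) measure" where
  "lborel_pow d \<equiv> \<Pi>\<^sub>M i\<in>{..<d}. lborel"

text \<open>The values outside \<open>{..<d}\<close> are \<open>undefined\<close> because the space
  of the product measure consists of the extensional functions. The same applies to
  \<open>vdiff\<close> and \<open>linmap\<close>.\<close>

definition vadd :: "nat \<Rightarrow> (nat \<Rightarrow> real) \<Rightarrow> (nat \<Rightarrow> real) \<Rightarrow> nat \<Rightarrow> real" where
  "vadd d x y = (\<lambda>i\<in>{..<d}. x i + y i)"

definition vdiff :: "nat \<Rightarrow> (nat \<Rightarrow> real) \<Rightarrow> (nat \<Rightarrow> real) \<Rightarrow> nat \<Rightarrow> real" where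
  "vdiff d x y = (\<lambda>i\<in>{..<d}. x i - y i)"

definition linmap :: "nat \<Rightarrow> (nat \<Rightarrow> nat \<Rightarrow> int) \<Rightarrow> (nat \<Rightarrow> real) \<Rightarrow> nat \<Rightarrow> real" where
  "linmap d U t = (\<lambda>i\<in>{..<d}. \<Sum>j<d. of_int (U i j) * t j)"

lemma product_sigma_finite_lborel: "product_sigma_finite (\<lambda>_::nat. lborel :: real measure)"
  by (simp add: product_sigma_finite_def lborel.sigma_finite_measure_axioms)

lemma space_lborel_pow: "space (lborel_pow d) = extensional {..<d}"
  by (auto simp: space_PiM PiE_def)

lemma measurable_component [measurable]:
  "i < d \<Longrightarrow> (\<lambda>t. t i) \<in> borel_measurable (lborel_pow d)"
  using measurable_component_singleton[of i "{..<d}" "\<lambda>_. lborel"] by simp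

lemma measurable_vadd [measurable]:
  assumes "f \<in> M \<rightarrow>\<^sub>M lborel_pow d" "g \<in> M \<rightarrow>\<^sub>M lborel_pow d"
  shows "(\<lambda>x. vadd d (f x) (g x)) \<in> M \<rightarrow>\<^sub>M lborel_pow d"
  unfolding vadd_def
proof (rule measurable_restrict)
  fix i assume i: "i \<in> {..<d}"
  then have [measurable]: "(\<lambda>x. f x i) \<in> borel_measurable M" "(\<lambda>x. g x i) \<in> borel_measurable M"
    using measurable_compose[OF assms(1) measurable_component, of i]
      measurable_compose[OF assms(2) measurable_component, of i] by auto
  show "(\<lambda>x. f x i + g x i) \<in> M \<rightarrow>\<^sub>M lborel" by simp
qed

lemma measurable_vdiff [measurable]:
  assumes "f \<in> M \<rightarrow>\<^sub>M lborel_pow d" "g \<in> M \<rightarrow>\<^sub>M lborel_pow d"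
  shows "(\<lambda>x. vdiff d (f x) (g x)) \<in> M \<rightarrow>\<^sub>M lborel_pow d"
  unfolding vdiff_def
proof (rule measurable_restrict)
  fix i assume i: "i \<in> {..<d}"
  then have [measurable]: "(\<lambda>x. f x i) \<in> borel_measurable M" "(\<lambda>x. g x i) \<in> borel_measurable M"
    using measurable_compose[OF assms(1) measurable_component, of i]
      measurable_compose[OF assms(2) measurable_component, of i] by auto
  show "(\<lambda>x. f x i - g x i) \<in> M \<rightarrow>\<^sub>M lborel" by simp
qed

lemma measurable_linmap [measurable]: "linmap d U \<in> lborel_pow d \<rightarrow>\<^sub>M lborel_pow d"
  unfolding linmap_def[abs_def] by (rule measurable_restrict) simp

lemma linmap_outside: "\<not> i < d \<Longrightarrow> linmap d A t i = undefined"
  by (simp add: linmap_def)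

lemma vadd_in_space: "vadd d x y \<in> space (lborel_pow d)"
  by (simp add: vadd_def space_lborel_pow)

text \<open>A product measure is determined by its values on boxes; the preimage of a box under a
  translation is a box with translated sides, and \<open>lborel\<close> on the line is translation
  invariant.\<close>

lemma distr_vadd: "distr (lborel_pow d) (lborel_pow d) (\<lambda>t. vadd d t c) = lborel_pow d"
proof -
  interpret product_sigma_finite "\<lambda>_::nat. lborel :: real measure"
    by (rule product_sigma_finite_lborel)
  have m: "(\<lambda>t. vadd d t c) \<in> lborel_pow d \<rightarrow>\<^sub>M lborel_pow d"
    unfolding vadd_def by (rule measurable_restrict) simp
  show ?thesis
  proof (rule PiM_eqI)
    fix A :: "nat \<Rightarrow> real set" assume A: "\<And>i. i \<in> {..<d} \<Longrightarrow> A i \<in> sets lborel"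
    have "(\<lambda>t. vadd d t c) -` Pi\<^sub>E {..<d} A \<inter> space (lborel_pow d)
        = Pi\<^sub>E {..<d} (\<lambda>i. (\<lambda>x. x + c i) -` A i)"
      by (auto simp: space_PiM vadd_def PiE_def Pi_def)
    moreover have "emeasure lborel ((\<lambda>x. x + c i) -` A i) = emeasure lborel (A i)" if "i < d" for i
    proof -
      have "emeasure lborel (A i) = emeasure (distr lborel borel ((+) (c i))) (A i)"
        by (simp add: lborel_distr_plus)
      also have "\<dots> = emeasure lborel ((\<lambda>x. x + c i) -` A i)"
        using A[of i] that by (subst emeasure_distr) (auto simp: vimage_def add.commute)
      finally show ?thesis ..
    qed
    moreover have "(\<lambda>x. x + c i) -` A i \<in> sets lborel" if "i < d" for i
      using measurable_sets[of "\<lambda>x. x + c i" borel borel "A i"] A[of i] that by auto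
    ultimately show "emeasure (distr (lborel_pow d) (lborel_pow d) (\<lambda>t. vadd d t c)) (Pi\<^sub>E {..<d} A)
        = (\<Prod>i\<in>{..<d}. emeasure lborel (A i))"
      using A by (subst emeasure_distr[OF m]) (simp_all add: sets_PiM_I_finite, subst emeasure_PiM, auto)
  qed auto
qed

lemma measurable_vadd_const [measurable]: "(\<lambda>t. vadd d t c) \<in> lborel_pow d \<rightarrow>\<^sub>M lborel_pow d"
  unfolding vadd_def by (rule measurable_restrict) simp

lemma nn_integral_vadd:
  assumes [measurable]: "f \<in> borel_measurable (lborel_pow d)"
  shows "(\<integral>\<^sup>+t. f (vadd d t c) \<partial>lborel_pow d) = (\<integral>\<^sup>+t. f t \<partial>lborel_pow d)"
  by (subst (2) distr_vadd[symmetric, of d c], subst nn_integral_distr) auto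

lemma vadd_commute: "vadd d x y = vadd d y x"
  by (simp add: vadd_def add.commute)

section \<open>Integer points and the unit cube as their fundamental domain\<close>

definition int_points :: "nat \<Rightarrow> (nat \<Rightarrow> real) set" where
  "int_points d = Pi\<^sub>E {..<d} (\<lambda>_. \<int>)"

text \<open>Half-open, so that the integer translates tile the space without overlap.\<close>

definition cube :: "nat \<Rightarrow> (nat \<Rightarrow> real) set" where
  "cube d = Pi\<^sub>E {..<d} (\<lambda>_. {0..<1})"

lemma sigma_finite_lborel_pow: "sigma_finite_measure (lborel_pow d)"
proof -
  interpret finite_product_sigma_finite "\<lambda>_::nat. lborel :: real measure" "{..<d}"
    by (simp add: finite_product_sigma_finite_def product_sigma_finite_lborel
      finite_product_sigma_finite_axioms_def)
  show ?thesis by unfold_locales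
qed

lemma emeasure_lborel_pow_PiE_1:
  assumes "\<And>i. i < d \<Longrightarrow> A i \<in> sets borel" "\<And>i. i < d \<Longrightarrow> emeasure lborel (A i) = 1"
  shows "emeasure (lborel_pow d) (Pi\<^sub>E {..<d} A) = 1"
proof -
  interpret product_sigma_finite "\<lambda>_::nat. lborel :: real measure"
    by (rule product_sigma_finite_lborel)
  show ?thesis using assms by (subst emeasure_PiM) auto
qed

lemma countable_int_points: "countable (int_points d)"
  unfolding int_points_def by (intro countable_PiE) (auto simp: Ints_def)

lemma linmap_int_points: "z \<in> int_points d \<Longrightarrow> linmap d A z \<in> int_points d"
  unfolding int_points_def linmap_def PiE_iff
  by (auto intro: Ints_sum[of "{..<d}" "\<lambda>j. of_int (A i j) * z j" for i])

lemma sets_cube [measurable]: "cube d \<in> sets (lborel_pow d)"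
  unfolding cube_def by (intro sets_PiM_I_finite) auto

text \<open>The only contribution comes from the coordinatewise floor of \<open>t\<close>. The
  tiling is stated as an integral over counting measure so that it can be exchanged with Lebesgue
  integrals.\<close>

lemma nn_integral_int_points_cube:
  "(\<integral>\<^sup>+z. indicator (cube d) (vdiff d t z) \<partial>count_space (int_points d)) = (1 :: ennreal)"
proof -
  let ?w = "\<lambda>i\<in>{..<d}. of_int \<lfloor>t i\<rfloor> :: real"
  have w: "?w \<in> int_points d" by (auto simp: int_points_def)
  have int: "z = of_int \<lfloor>x\<rfloor> \<longleftrightarrow> z \<le> x \<and> x < 1 + z" if "z \<in> \<int>" for x z :: real
    using that by (elim Ints_cases) (simp, linarith)
  have "vdiff d t z \<in> cube d \<longleftrightarrow> z = ?w" if "z \<in> int_points d" for z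
  proof -
    have "z = ?w \<longleftrightarrow> (\<forall>i<d. z i = of_int \<lfloor>t i\<rfloor>)"
      using that by (auto simp: int_points_def fun_eq_iff PiE_iff extensional_def)
    also have "\<dots> \<longleftrightarrow> vdiff d t z \<in> cube d"
      using that by (auto simp: int_points_def cube_def vdiff_def PiE_iff int algebra_simps)
    finally show ?thesis ..
  qed
  then have "(\<integral>\<^sup>+z. indicator (cube d) (vdiff d t z) \<partial>count_space (int_points d))
      = (\<integral>\<^sup>+z. indicator {?w} z \<partial>count_space (int_points d))"
    by (intro nn_integral_cong) (auto simp: indicator_def)
  also have "\<dots> = 1"
    using w by (subst nn_integral_indicator) auto
  finally show ?thesis .
qed

lemma linmap_vadd: "linmap d A (vadd d x y) = vadd d (linmap d A x) (linmap d A y)"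
  by (auto simp: linmap_def vadd_def fun_eq_iff distrib_left sum.distrib)

text \<open>Invertibility over the integers is expressed by the action on vectors, which is what a
  change of lattice basis yields directly.\<close>

locale unimodular =
  fixes d :: nat and U W :: "nat \<Rightarrow> nat \<Rightarrow> int"
  assumes UW: "linmap d U (linmap d W t) = restrict t {..<d}"
    and WU: "linmap d W (linmap d U t) = restrict t {..<d}"
begin

text \<open>The negative of \<open>U\<close> permutes the integer points, with the negative of
  \<open>W\<close> as inverse; reindexing by it reduces the count to
  \<open>nn_integral_int_points_cube\<close>.\<close>

lemma nn_integral_linmap_int_points_cube:
  "(\<integral>\<^sup>+z. indicator (cube d) (vadd d t (linmap d U z)) \<partial>count_space (int_points d)) = (1 :: ennreal)"
proof -
  let ?U = "\<lambda>i j. - U i j" and ?W = "\<lambda>i j. - W i j"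
  have neg: "linmap d (\<lambda>i j. - A i j) (linmap d (\<lambda>i j. - B i j) z) = linmap d A (linmap d B z)" for A B z
    by (auto simp: linmap_def fun_eq_iff sum_negf)
  have res: "restrict z {..<d} = z" if "z \<in> int_points d" for z
    using that by (auto simp: int_points_def PiE_iff extensional_restrict)
  have bij: "bij_betw (linmap d ?U) (int_points d) (int_points d)"
    by (rule bij_betw_byWitness[where f' = "linmap d ?W"])
       (auto simp: neg UW WU res linmap_int_points)
  have "vadd d t (linmap d U z) = vdiff d t (linmap d ?U z)" for z
    by (auto simp: vadd_def vdiff_def linmap_def sum_negf fun_eq_iff)
  then show ?thesis
    using nn_integral_bij_count_space[OF bij, of "\<lambda>z. indicator (cube d) (vdiff d t z)"]
    by (simp add: nn_integral_int_points_cube)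
qed

text \<open>The cube and its preimage are both fundamental domains of the translation action of the
  integer points, so they have the same measure.\<close>

lemma nn_integral_linmap_cube:
  "(\<integral>\<^sup>+t. indicator (cube d) (linmap d U t) \<partial>lborel_pow d) = 1"
proof -
  let ?L = "lborel_pow d" and ?C = "indicator (cube d) :: _ \<Rightarrow> ennreal"
    and ?Z = "count_space (int_points d)"
  \<comment> \<open>Substituting \<open>t + z\<close> for \<open>t\<close> moves the shift by
    \<open>z\<close> from the second factor into the first.\<close>
  have eq: "(\<integral>\<^sup>+t. ?C (linmap d U t) * ?C (vdiff d t z) \<partial>?L)
      = (\<integral>\<^sup>+t. ?C (vadd d (linmap d U t) (linmap d U z)) * ?C t \<partial>?L)" for z
  proof -
    have c: "(\<lambda>t. vdiff d t z) \<in> ?L \<rightarrow>\<^sub>M ?L"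
      unfolding vdiff_def by (rule measurable_restrict) simp
    have "(\<integral>\<^sup>+t. ?C (linmap d U t) * ?C (vdiff d t z) \<partial>?L)
        = (\<integral>\<^sup>+t. ?C (linmap d U (vadd d t z)) * ?C (vdiff d (vadd d t z) z) \<partial>?L)"
      by (rule nn_integral_vadd[symmetric]) (use c in measurable)
    also have "\<dots> = (\<integral>\<^sup>+t. ?C (vadd d (linmap d U t) (linmap d U z)) * ?C t \<partial>?L)"
    proof (rule nn_integral_cong)
      fix t assume "t \<in> space ?L"
      then have "vdiff d (vadd d t z) z = t"
        by (auto simp: vdiff_def vadd_def space_lborel_pow extensional_def fun_eq_iff)
      then show "?C (linmap d U (vadd d t z)) * ?C (vdiff d (vadd d t z) z)
        = ?C (vadd d (linmap d U t) (linmap d U z)) * ?C t"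
        by (simp add: linmap_vadd)
    qed
    finally show ?thesis .
  qed
  have c: "(\<lambda>t. vdiff d t z) \<in> ?L \<rightarrow>\<^sub>M ?L" for z
    unfolding vdiff_def by (rule measurable_restrict) simp
  \<comment> \<open>The inserted factor is 1 by the tiling; it cuts the preimage of the cube into
    its pieces in the integer translates of the cube.\<close>
  have "(\<integral>\<^sup>+t. ?C (linmap d U t) \<partial>?L) = (\<integral>\<^sup>+t. \<integral>\<^sup>+z. ?C (linmap d U t) * ?C (vdiff d t z) \<partial>?Z \<partial>?L)"
    by (subst nn_integral_cmult) (auto simp: nn_integral_int_points_cube)
  also have "\<dots> = (\<integral>\<^sup>+z. \<integral>\<^sup>+t. ?C (linmap d U t) * ?C (vdiff d t z) \<partial>?L \<partial>?Z)"
    by (rule nn_integral_count_space_nn_integral[OF countable_int_points]) (use c in measurable)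
  also have "\<dots> = (\<integral>\<^sup>+z. \<integral>\<^sup>+t. ?C (vadd d (linmap d U t) (linmap d U z)) * ?C t \<partial>?L \<partial>?Z)"
    by (simp add: eq)
  also have "\<dots> = (\<integral>\<^sup>+t. \<integral>\<^sup>+z. ?C (vadd d (linmap d U t) (linmap d U z)) * ?C t \<partial>?Z \<partial>?L)"
    by (rule nn_integral_count_space_nn_integral[OF countable_int_points, symmetric]) measurable
  \<comment> \<open>For each \<open>t\<close> exactly one \<open>z\<close> brings
    \<open>U (t + z)\<close> into the cube, so the pieces, shifted back, cover the cube
    once.\<close>
  also have "\<dots> = (\<integral>\<^sup>+t. ?C t \<partial>?L)"
    by (subst nn_integral_multc) (auto simp: nn_integral_linmap_int_points_cube)
  also have "\<dots> = 1"
    using emeasure_lborel_pow_PiE_1[of d "\<lambda>_. {0..<1}"] by (simp add: cube_def sets_PiM_I_finite)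
  finally show ?thesis .
qed

text \<open>As \<open>x = U (W x)\<close>, translating by \<open>x\<close> after \<open>U\<close> is
  translating by \<open>W x\<close> before \<open>U\<close>, and Lebesgue measure is invariant under
  the latter.\<close>

lemma nn_integral_linmap_translate:
  assumes [measurable]: "f \<in> borel_measurable (lborel_pow d)" and x: "x \<in> space (lborel_pow d)"
  shows "(\<integral>\<^sup>+t. f (vadd d (linmap d U t) x) \<partial>lborel_pow d) = (\<integral>\<^sup>+t. f (linmap d U t) \<partial>lborel_pow d)"
proof -
  have "restrict x {..<d} = x"
    using x by (simp add: space_lborel_pow extensional_restrict)
  then have "vadd d (linmap d U t) x = linmap d U (vadd d t (linmap d W x))" for t
    by (simp add: linmap_vadd UW)
  then show ?thesis
    by (simp add: nn_integral_vadd[of "\<lambda>t. f (linmap d U t)"])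
qed

text \<open>The uniqueness argument for Haar measure: integrating \<open>q x * g (x + U t)\<close> over both
  variables in either order shows that the image of Lebesgue measure under \<open>U\<close> is a multiple of
  Lebesgue measure; for \<open>q\<close> the indicator of the reflected cube the factor is 1.\<close>

lemma nn_integral_linmap:
  assumes [measurable]: "g \<in> borel_measurable (lborel_pow d)"
  shows "(\<integral>\<^sup>+t. g (linmap d U t) \<partial>lborel_pow d) = (\<integral>\<^sup>+t. g t \<partial>lborel_pow d)"
proof -
  let ?L = "lborel_pow d" and ?T = "linmap d U"
  interpret pair_sigma_finite ?L ?L
    by (intro pair_sigma_finite.intro sigma_finite_lborel_pow)
  define q where "q = (indicator (Pi\<^sub>E {..<d} (\<lambda>_. {-1<..0})) :: (nat \<Rightarrow> real) \<Rightarrow> ennreal)"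
  have q [measurable]: "q \<in> borel_measurable ?L"
    unfolding q_def by (intro borel_measurable_indicator sets_PiM_I_finite) auto
  have q1: "(\<integral>\<^sup>+x. q x \<partial>?L) = 1"
    using emeasure_lborel_pow_PiE_1[of d "\<lambda>_. {-1<..0}"] by (simp add: q_def sets_PiM_I_finite)
  define zv where "zv = (\<lambda>i\<in>{..<d}. 0 :: real)"
  have zv [measurable]: "zv \<in> space ?L" by (simp add: zv_def space_lborel_pow)
  have qT: "q (vdiff d zv (?T t)) = indicator (cube d) (?T t)" for t
    by (auto simp: q_def cube_def vdiff_def zv_def linmap_def indicator_def PiE_iff)
  \<comment> \<open>Translation by \<open>x\<close> reduces this to \<open>x = 0\<close>, where the
    integrand is the indicator of the preimage of the cube.\<close>
  have shift: "(\<integral>\<^sup>+t. q (vdiff d x (?T t)) \<partial>?L) = 1" if x: "x \<in> space ?L" for x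
  proof -
    have [measurable]: "(\<lambda>t. vdiff d x t) \<in> ?L \<rightarrow>\<^sub>M ?L"
      using x by measurable
    have "(\<integral>\<^sup>+t. q (vdiff d x (?T t)) \<partial>?L) = (\<integral>\<^sup>+t. q (vdiff d x (vadd d (?T t) x)) \<partial>?L)"
      using nn_integral_linmap_translate[OF _ x, of "\<lambda>s. q (vdiff d x s)"] by simp
    also have "\<dots> = (\<integral>\<^sup>+t. q (vdiff d zv (?T t)) \<partial>?L)"
      by (intro nn_integral_cong arg_cong[where f = q]) (auto simp: vdiff_def vadd_def zv_def)
    also have "\<dots> = 1" by (simp add: qT nn_integral_linmap_cube)
    finally show ?thesis .
  qed
  have "(\<integral>\<^sup>+t. g (?T t) \<partial>?L) = (\<integral>\<^sup>+x. q x * (\<integral>\<^sup>+t. g (?T t) \<partial>?L) \<partial>?L)"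
    by (subst nn_integral_multc) (simp_all add: q1)
  also have "\<dots> = (\<integral>\<^sup>+x. \<integral>\<^sup>+t. q x * g (vadd d (?T t) x) \<partial>?L \<partial>?L)"
  proof (rule nn_integral_cong)
    fix x assume x [measurable]: "x \<in> space ?L"
    have "(\<integral>\<^sup>+t. q x * g (vadd d (?T t) x) \<partial>?L) = q x * (\<integral>\<^sup>+t. g (vadd d (?T t) x) \<partial>?L)"
      by (rule nn_integral_cmult) measurable
    then show "q x * (\<integral>\<^sup>+t. g (?T t) \<partial>?L) = (\<integral>\<^sup>+t. q x * g (vadd d (?T t) x) \<partial>?L)"
      by (simp add: nn_integral_linmap_translate[OF _ x])
  qed
  also have "\<dots> = (\<integral>\<^sup>+t. \<integral>\<^sup>+x. q x * g (vadd d (?T t) x) \<partial>?L \<partial>?L)"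
    by (rule Fubini'[symmetric]) measurable
  \<comment> \<open>For fixed \<open>t\<close>, substituting \<open>x - U t\<close> for
    \<open>x\<close> frees \<open>g\<close> of \<open>t\<close>; after the next exchange of
    integrals only \<open>q\<close> is integrated over \<open>t\<close>, with value 1 by
    \<open>shift\<close>.\<close>
  also have "\<dots> = (\<integral>\<^sup>+t. \<integral>\<^sup>+x. q (vdiff d x (?T t)) * g x \<partial>?L \<partial>?L)"
  proof (rule nn_integral_cong)
    fix t assume [measurable]: "t \<in> space ?L"
    have [measurable]: "?T t \<in> space ?L" by (simp add: linmap_def space_lborel_pow)
    have "(\<integral>\<^sup>+x. q (vdiff d x (?T t)) * g x \<partial>?L)
        = (\<integral>\<^sup>+x. q (vdiff d (vadd d x (?T t)) (?T t)) * g (vadd d x (?T t)) \<partial>?L)"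
      by (rule nn_integral_vadd[symmetric]) measurable
    also have "\<dots> = (\<integral>\<^sup>+x. q x * g (vadd d (?T t) x) \<partial>?L)"
    proof (rule nn_integral_cong)
      fix x assume "x \<in> space ?L"
      then have "vdiff d (vadd d x (?T t)) (?T t) = x"
        by (auto simp: vdiff_def vadd_def space_lborel_pow extensional_def fun_eq_iff)
      then show "q (vdiff d (vadd d x (?T t)) (?T t)) * g (vadd d x (?T t)) = q x * g (vadd d (?T t) x)"
        by (simp add: vadd_commute)
    qed
    finally show "(\<integral>\<^sup>+x. q x * g (vadd d (?T t) x) \<partial>?L) = (\<integral>\<^sup>+x. q (vdiff d x (?T t)) * g x \<partial>?L)" ..
  qed
  also have "\<dots> = (\<integral>\<^sup>+x. \<integral>\<^sup>+t. q (vdiff d x (?T t)) * g x \<partial>?L \<partial>?L)"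
    by (rule Fubini') measurable
  also have "\<dots> = (\<integral>\<^sup>+x. g x \<partial>?L)"
  proof (rule nn_integral_cong)
    fix x assume x [measurable]: "x \<in> space ?L"
    have "(\<integral>\<^sup>+t. q (vdiff d x (?T t)) * g x \<partial>?L) = (\<integral>\<^sup>+t. q (vdiff d x (?T t)) \<partial>?L) * g x"
      by (rule nn_integral_multc) measurable
    then show "(\<integral>\<^sup>+t. q (vdiff d x (?T t)) * g x \<partial>?L) = g x"
      by (simp add: shift[OF x])
  qed
  finally show ?thesis .
qed

end

section \<open>Independence of the lattice basis\<close>

lemma lattice_basis_coords_unique:
  assumes "lattice_basis d B L"
    and "\<And>e. (\<Sum>i<d. s i * B i e) = (\<Sum>i<d. t i * B i e)" and "i < d"
  shows "s i = t i"
proof -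
  have "(\<Sum>i<d. (s i - t i) * B i e) = 0" for e
    using assms(2)[of e] by (simp add: left_diff_distrib sum_subtractf)
  then show ?thesis
    using assms(1,3) unfolding lattice_basis_def
    by (auto dest!: spec[of _ "\<lambda>i. s i - t i"])
qed

lemma lattice_basis_mem:
  assumes "lattice_basis d B L" "i < d"
  shows "B i \<in> L"
proof -
  have eq: "B i = (\<lambda>e. \<Sum>j<d. of_int (if j = i then 1 else 0) * B j e)"
  proof
    fix e
    have "(\<Sum>j<d. of_int (if j = i then 1 else 0) * B j e) = (\<Sum>j<d. if j = i then B j e else 0)"
      by (intro sum.cong) auto
    then show "B i e = (\<Sum>j<d. of_int (if j = i then 1 else 0) * B j e)"
      using assms(2) by simp
  qed
  have L: "L = {(\<lambda>e. \<Sum>i<d. of_int (c i) * B i e) | c :: nat \<Rightarrow> int. True}"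
    using assms(1) by (simp add: lattice_basis_def)
  show ?thesis
    by (subst L, rule CollectI, rule exI, rule conjI[OF eq TrueI])
qed

lemma lattice_basis_change:
  assumes "lattice_basis d B L" "lattice_basis d B' L"
  obtains U where "\<And>t e. (\<Sum>i<d. t i * B i e) = (\<Sum>i<d. linmap d U t i * B' i e)"
proof -
  have "\<exists>c :: nat \<Rightarrow> int. B i = (\<lambda>e. \<Sum>j<d. of_int (c j) * B' j e)" if "i < d" for i
    using lattice_basis_mem[OF assms(1) that] assms(2) unfolding lattice_basis_def by blast
  then obtain D :: "nat \<Rightarrow> nat \<Rightarrow> int" where
    D: "\<And>i. i < d \<Longrightarrow> B i = (\<lambda>e. \<Sum>j<d. of_int (D i j) * B' j e)"
    by metis
  \<comment> \<open>Row \<open>i\<close> of \<open>D\<close> holds the coordinates of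
    \<open>B i\<close>, so coordinate vectors change by the transpose.\<close>
  have "(\<Sum>i<d. t i * B i e) = (\<Sum>i<d. linmap d (\<lambda>i j. D j i) t i * B' i e)" for t e
  proof -
    have "(\<Sum>i<d. t i * B i e) = (\<Sum>i<d. \<Sum>j<d. t i * (of_int (D i j) * B' j e))"
      by (intro sum.cong) (simp_all add: D sum_distrib_left)
    also have "\<dots> = (\<Sum>j<d. \<Sum>i<d. t i * (of_int (D i j) * B' j e))"
      by (rule sum.swap)
    also have "\<dots> = (\<Sum>i<d. linmap d (\<lambda>i j. D j i) t i * B' i e)"
      by (intro sum.cong) (simp_all add: linmap_def sum_distrib_left sum_distrib_right mult_ac)
    finally show ?thesis .
  qed
  then show ?thesis by (rule that)
qed

text \<open>Evaluates the definite description from a single choice of basis and base point: any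
  other choice changes the coordinates by an invertible integer matrix and a translation, both
  measure preserving. The assumption on spanning provides the translation vector.\<close>

lemma lattice_volume_eq:
  assumes B: "lattice_basis d B L" and p: "p \<in> A"
    and span: "\<And>q. q \<in> A \<Longrightarrow> \<exists>t. q = (\<lambda>e. p e + (\<Sum>i<d. t i * B i e))"
    and meas: "{t \<in> space (lborel_pow d). (\<lambda>e. p e + (\<Sum>i<d. t i * B i e)) \<in> S} \<in> sets (lborel_pow d)"
      (is "?X \<in> _")
  shows "lattice_volume d L A S = measure (lborel_pow d) ?X"
  unfolding lattice_volume_def
proof (rule the_equality, goal_cases)
  case 1
  show ?case using B p by blast
next
  case (2 v)
  then obtain B' q where B': "lattice_basis d B' L" and q: "q \<in> A"
    and v: "v = measure (lborel_pow d)
              {t \<in> space (lborel_pow d). (\<lambda>e. q e + (\<Sum>i<d. t i * B' i e)) \<in> S}"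
    by blast
  obtain U where U: "\<And>t e. (\<Sum>i<d. t i * B' i e) = (\<Sum>i<d. linmap d U t i * B i e)"
    using lattice_basis_change[OF B' B] by metis
  obtain W where W: "\<And>t e. (\<Sum>i<d. t i * B i e) = (\<Sum>i<d. linmap d W t i * B' i e)"
    using lattice_basis_change[OF B B'] by metis
  \<comment> \<open>Changing to the other basis and back represents the same vector, so uniqueness
    of coordinates makes \<open>U\<close> and \<open>W\<close> mutually inverse.\<close>
  interpret unimodular d U W
  proof
    fix t
    show "linmap d U (linmap d W t) = restrict t {..<d}"
    proof
      fix i
      show "linmap d U (linmap d W t) i = restrict t {..<d} i"
        using lattice_basis_coords_unique[OF B, of "linmap d U (linmap d W t)" t i]
        by (cases "i < d") (simp_all add: U[symmetric] W[symmetric] linmap_outside)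
    qed
    show "linmap d W (linmap d U t) = restrict t {..<d}"
    proof
      fix i
      show "linmap d W (linmap d U t) i = restrict t {..<d} i"
        using lattice_basis_coords_unique[OF B', of "linmap d W (linmap d U t)" t i]
        by (cases "i < d") (simp_all add: U[symmetric] W[symmetric] linmap_outside)
    qed
  qed
  obtain \<tau> where \<tau>: "q = (\<lambda>e. p e + (\<Sum>i<d. \<tau> i * B i e))"
    using span[OF q] by blast
  let ?L = "lborel_pow d"
  let ?Y = "{t \<in> space ?L. (\<lambda>e. q e + (\<Sum>i<d. t i * B' i e)) \<in> S}"
  have "(\<Sum>i<d. vadd d (linmap d U t) \<tau> i * B i e)
      = (\<Sum>i<d. \<tau> i * B i e) + (\<Sum>i<d. t i * B' i e)" for t e
    by (simp add: U vadd_def distrib_right sum.distrib)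
  \<comment> \<open>In coordinates the second set is the preimage of the first under
    \<open>U\<close> followed by translation by \<open>\<tau>\<close>.\<close>
  then have Y: "?Y = {t \<in> space ?L. vadd d (linmap d U t) \<tau> \<in> ?X}"
    using vadd_in_space by (auto simp: \<tau> add.assoc)
  note [measurable] = meas
  have "?Y \<in> sets ?L"
    unfolding Y by measurable
  then have "emeasure ?L ?Y = (\<integral>\<^sup>+t. indicator ?Y t \<partial>?L)" by simp
  also have "\<dots> = (\<integral>\<^sup>+t. indicator ?X (vadd d (linmap d U t) \<tau>) \<partial>?L)"
    by (intro nn_integral_cong) (unfold Y, simp add: indicator_def)
  also have "\<dots> = (\<integral>\<^sup>+t. indicator ?X (vadd d t \<tau>) \<partial>?L)"
    by (rule nn_integral_linmap[of "\<lambda>t. indicator ?X (vadd d t \<tau>)"]) measurable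
  also have "\<dots> = (\<integral>\<^sup>+t. indicator ?X t \<partial>?L)"
    by (rule nn_integral_vadd) measurable
  also have "\<dots> = emeasure ?L ?X"
    using meas by simp
  finally show ?case
    by (simp add: v measure_def)
qed

section \<open>The iterated integral\<close>

text \<open>\<open>s\<close> is what remains of the bound on the sum of the even coordinates, and
  \<open>y\<close> is the preceding odd coordinate. Removing the two highest indices leaves
  \<open>{..<2*k}\<close>, so the recursion needs no reindexing.\<close>

fun region :: "nat \<Rightarrow> real \<Rightarrow> real \<Rightarrow> (nat \<Rightarrow> real) \<Rightarrow> bool" where
  "region 0 s y t \<longleftrightarrow> True"
| "region (Suc k) s y t \<longleftrightarrow> t (2*k) \<in> {0..s} \<and> t (2*k+1) \<in> {0..y + t (2*k)} \<and>
     region k (s - t (2*k)) (t (2*k+1)) t"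

text \<open>The factor in parentheses is the derivative of $y(s+y)^k$ with respect to $y$. The integral of
  $V_k(s-x,\cdot)$ over $[0,y+x]$ therefore contains the power $(s+y)^k$, which is constant in $x$; this
  is why the second integration is elementary.\<close>

definition region_vol :: "nat \<Rightarrow> real \<Rightarrow> real \<Rightarrow> real" where
  "region_vol k s y = s ^ k * ((s + y) ^ k + real k * y * (s + y) ^ (k-1)) / (fact k * fact (Suc k))"

lemma region_cong: "(\<And>i. i < 2*k \<Longrightarrow> t i = t' i) \<Longrightarrow> region k s y t = region k s y t'"
  by (induction k arbitrary: s y) auto

text \<open>\<open>f\<close> and \<open>g\<close> vary with the point because the recursive call
  replaces \<open>s\<close> and \<open>y\<close> by expressions in the coordinates.\<close>

lemma pred_region:
  assumes "\<And>i. i < 2*k \<Longrightarrow> (\<lambda>x. h x i) \<in> borel_measurable M"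
    and "f \<in> borel_measurable M" "g \<in> borel_measurable M"
  shows "Measurable.pred M (\<lambda>x. region k (f x) (g x) (h x))"
  using assms
proof (induction k arbitrary: f g)
  case (Suc k)
  have [measurable]: "(\<lambda>x. h x (2*k)) \<in> borel_measurable M" "(\<lambda>x. h x (2*k+1)) \<in> borel_measurable M"
    using Suc.prems(1) by auto
  note [measurable] = Suc.prems(2,3)
  have [measurable]: "Measurable.pred M (\<lambda>x. region k (f x - h x (2*k)) (h x (2*k+1)) (h x))"
    using Suc.prems(1) by (intro Suc.IH) auto
  show ?case
    unfolding region.simps atLeastAtMost_iff by measurable
qed simp

lemma sets_region:
  assumes "2*k \<le> d"
  shows "{t \<in> space (lborel_pow d). region k s y t} \<in> sets (lborel_pow d)"
  using pred_region[of k "\<lambda>t. t" "lborel_pow d" "\<lambda>_. s" "\<lambda>_. y"] assms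
  by (auto simp: pred_def)

lemma nn_integral_region_vol:
  assumes "0 \<le> s" "0 \<le> y"
  shows "(\<integral>\<^sup>+x. (\<integral>\<^sup>+y'. ennreal (region_vol k (s - x) y') * indicator {0..y + x} y' \<partial>lborel)
      * indicator {0..s} x \<partial>lborel) = ennreal (region_vol (Suc k) s y)"
proof -
  define c :: real where "c = fact k * fact (Suc k)"
  have c: "c > 0" by (simp add: c_def)
  have vol: "region_vol k u v = u ^ k * ((u + v) ^ k + real k * v * (u + v) ^ (k-1)) / c" for u v
    by (simp add: region_vol_def c_def)
  \<comment> \<open>The antiderivative is \<open>(s - x) ^ k * y' * (s - x + y') ^ k / c\<close>; at
    \<open>y' = y + x\<close> the last base becomes \<open>s + y\<close>.\<close>
  have inner: "(\<integral>\<^sup>+y'. ennreal (region_vol k (s - x) y') * indicator {0..y + x} y' \<partial>lborel)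
      = ennreal ((s - x) ^ k * (y + x) * (s + y) ^ k / c)" if x: "x \<in> {0..s}" for x
  proof -
    have "(\<integral>\<^sup>+y'. ennreal (region_vol k (s - x) y') * indicator {0..y + x} y' \<partial>lborel)
       = ennreal ((s - x) ^ k * (y + x) * (s - x + (y + x)) ^ k / c - (s - x) ^ k * 0 * (s - x + 0) ^ k / c)"
      using assms x c
      by (intro nn_integral_FTC_Icc[where F = "\<lambda>y'. (s - x) ^ k * y' * (s - x + y') ^ k / c"])
         (auto simp: vol field_simps
            intro!: derivative_eq_intros borel_measurable_continuous_onI continuous_intros)
    then show ?thesis by simp
  qed
  \<comment> \<open>Writing \<open>y + x\<close> as \<open>(s + y) - (s - x)\<close> turns the
    integrand into a difference of two powers of \<open>s - x\<close>, integrated termwise.\<close>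
  let ?H = "\<lambda>x. (s + y) ^ k / c * ((s - x) ^ (k + 2) / (k + 2) - (s + y) * (s - x) ^ (k + 1) / (k + 1))"
  have "(\<integral>\<^sup>+x. (\<integral>\<^sup>+y'. ennreal (region_vol k (s - x) y') * indicator {0..y + x} y' \<partial>lborel)
      * indicator {0..s} x \<partial>lborel)
    = (\<integral>\<^sup>+x. ennreal ((s - x) ^ k * (y + x) * (s + y) ^ k / c) * indicator {0..s} x \<partial>lborel)"
  proof (rule nn_integral_cong)
    fix x
    show "(\<integral>\<^sup>+y'. ennreal (region_vol k (s - x) y') * indicator {0..y + x} y' \<partial>lborel) * indicator {0..s} x
      = ennreal ((s - x) ^ k * (y + x) * (s + y) ^ k / c) * indicator {0..s} x"
      by (cases "x \<in> {0..s}") (simp_all only: inner, simp)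
  qed
  also have "\<dots> = ennreal (?H s - ?H 0)"
  proof (rule nn_integral_FTC_Icc)
    fix x assume x: "x \<in> {0..s}"
    have 1: "((\<lambda>x. (s - x) ^ (k + 2) / real (k + 2)) has_real_derivative - ((s - x) ^ (k + 1))) (at x)"
      by (rule derivative_eq_intros refl | simp)+
    have 2: "((\<lambda>x. (s + y) * (s - x) ^ (k + 1) / real (k + 1)) has_real_derivative - ((s + y) * (s - x) ^ k)) (at x)"
      by (rule derivative_eq_intros refl | simp)+
    have "(?H has_real_derivative (s + y) ^ k / c * (- ((s - x) ^ (k + 1)) - - ((s + y) * (s - x) ^ k))) (at x)"
      by (intro DERIV_cmult DERIV_diff 1 2)
    also have "(s + y) ^ k / c * (- ((s - x) ^ (k + 1)) - - ((s + y) * (s - x) ^ k))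
       = (s - x) ^ k * (y + x) * (s + y) ^ k / c"
      by (simp add: algebra_simps diff_divide_distrib add_divide_distrib)
    finally show "(?H has_real_derivative (s - x) ^ k * (y + x) * (s + y) ^ k / c) (at x)" .
    show "0 \<le> (s - x) ^ k * (y + x) * (s + y) ^ k / c"
      using assms x c by simp
  qed (use assms in auto)
  also have "?H s - ?H 0 = region_vol (Suc k) s y"
  proof -
    \<comment> \<open>Factoring out \<open>(s + y) ^ k\<close> leaves
      \<open>(s + y) + (k + 1) * y\<close>.\<close>
    have "region_vol (Suc k) s y = s ^ Suc k * (s + y) ^ k * (s + (real k + 2) * y) / (c * (real k + 1) * (real k + 2))"
      by (simp add: region_vol_def c_def algebra_simps)
    also have "\<dots> = - ((s + y) ^ k / c * (s ^ (k + 2) / (k + 2) - (s + y) * s ^ (k + 1) / (k + 1)))"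
    proof -
      have "s ^ (k + 2) / (k + 2) - (s + y) * s ^ (k + 1) / (k + 1)
          = - (s ^ Suc k * (s + (real k + 2) * y) / ((real k + 1) * (real k + 2)))"
        by (simp add: divide_simps) (simp add: algebra_simps)
      then show ?thesis by (simp add: mult_ac)
    qed
    \<comment> \<open>\<open>?H s = 0\<close>, since both powers of \<open>s - x\<close> have
      positive exponent.\<close>
    also have "\<dots> = ?H s - ?H 0"
      by simp
    finally show ?thesis ..
  qed
  finally show ?thesis .
qed

lemma nn_integral_region:
  assumes "0 \<le> s" "0 \<le> y"
  shows "(\<integral>\<^sup>+t. of_bool (region k s y t) \<partial>lborel_pow (2*k)) = ennreal (region_vol k s y)"
  using assms
proof (induction k arbitrary: s y)
  case 0
  interpret product_sigma_finite "\<lambda>_::nat. lborel :: real measure"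
    by (rule product_sigma_finite_lborel)
  have "(\<integral>\<^sup>+t. of_bool (region 0 s y t) \<partial>Pi\<^sub>M {} (\<lambda>_::nat. lborel :: real measure)) = 1"
    by (subst nn_integral_empty) simp_all
  then show ?case
    by (simp add: region_vol_def)
next
  case (Suc k)
  interpret product_sigma_finite "\<lambda>_::nat. lborel :: real measure"
    by (rule product_sigma_finite_lborel)
  let ?I = "insert (2*k+1) {..<2*k}"
  \<comment> \<open>Index \<open>2*k\<close> is inserted last and so becomes the outermost variable
    \<open>x\<close>; the range of \<open>y'\<close> depends on it.\<close>
  have I: "{..<2 * Suc k} = insert (2*k) ?I" by auto
  have m: "(\<lambda>t. of_bool (region (Suc k) s y t) :: ennreal) \<in> borel_measurable (Pi\<^sub>M (insert (2*k) ?I) (\<lambda>_. lborel))"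
    unfolding I[symmetric]
    by (rule measurable_compose[OF pred_region]) (simp_all del: region.simps)
  have m': "(\<lambda>t. of_bool (region (Suc k) s y (t(2*k := x))) :: ennreal) \<in> borel_measurable (Pi\<^sub>M ?I (\<lambda>_. lborel))" for x
    by (rule measurable_compose[OF _ m]) measurable
  have "(\<integral>\<^sup>+t. of_bool (region (Suc k) s y t) \<partial>lborel_pow (2 * Suc k))
    = (\<integral>\<^sup>+x. \<integral>\<^sup>+t. of_bool (region (Suc k) s y (t(2*k := x))) \<partial>(Pi\<^sub>M ?I (\<lambda>_. lborel)) \<partial>lborel)"
    unfolding I by (rule product_nn_integral_insert_rev[OF _ _ m]) auto
  also have "\<dots> = (\<integral>\<^sup>+x. \<integral>\<^sup>+y'. \<integral>\<^sup>+t. of_bool (region (Suc k) s y (t(2*k+1 := y', 2*k := x)))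
      \<partial>lborel_pow (2*k) \<partial>lborel \<partial>lborel)"
    by (intro nn_integral_cong product_nn_integral_insert_rev[OF _ _ m']) auto
  also have "\<dots> = (\<integral>\<^sup>+x. \<integral>\<^sup>+y'. ennreal (region_vol k (s - x) y') * indicator {0..y + x} y'
      * indicator {0..s} x \<partial>lborel \<partial>lborel)"
  proof (intro nn_integral_cong)
    fix x y'
    have "(\<integral>\<^sup>+t. of_bool (region (Suc k) s y (t(2*k+1 := y', 2*k := x))) \<partial>lborel_pow (2*k))
      = (\<integral>\<^sup>+t. of_bool (x \<in> {0..s} \<and> y' \<in> {0..y+x} \<and> region k (s - x) y' t) \<partial>lborel_pow (2*k))"
    proof (rule nn_integral_cong)
      fix t
      have "region k (s - x) y' (t(2*k+1 := y', 2*k := x)) = region k (s - x) y' t"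
        by (rule region_cong) auto
      then show "of_bool (region (Suc k) s y (t(2*k+1 := y', 2*k := x)))
        = (of_bool (x \<in> {0..s} \<and> y' \<in> {0..y+x} \<and> region k (s - x) y' t) :: ennreal)"
        by simp
    qed
    \<comment> \<open>The induction hypothesis requires \<open>0 \<le> s - x\<close> and
      \<open>0 \<le> y'\<close>; if either fails, both sides are 0.\<close>
    also have "\<dots> = ennreal (region_vol k (s - x) y') * indicator {0..y + x} y' * indicator {0..s} x"
      using Suc.IH[of "s - x" y'] by (auto simp: indicator_def)
    finally show "(\<integral>\<^sup>+t. of_bool (region (Suc k) s y (t(2*k+1 := y', 2*k := x))) \<partial>lborel_pow (2*k))
      = ennreal (region_vol k (s - x) y') * indicator {0..y + x} y' * indicator {0..s} x" .
  qed
  also have "\<dots> = (\<integral>\<^sup>+x. (\<integral>\<^sup>+y'. ennreal (region_vol k (s - x) y') * indicator {0..y + x} y' \<partial>lborel)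
      * indicator {0..s} x \<partial>lborel)"
    by (intro nn_integral_cong nn_integral_multc)
       (auto simp: region_vol_def intro!: borel_measurable_continuous_onI continuous_intros)
  also have "\<dots> = ennreal (region_vol (Suc k) s y)"
    by (rule nn_integral_region_vol) fact+
  finally show ?case .
qed

lemma measure_region:
  assumes "0 \<le> s" "0 \<le> y"
  shows "measure (lborel_pow (2*k)) {t \<in> space (lborel_pow (2*k)). region k s y t} = region_vol k s y"
proof -
  let ?R = "{t \<in> space (lborel_pow (2*k)). region k s y t}"
  have "emeasure (lborel_pow (2*k)) ?R = (\<integral>\<^sup>+t. indicator ?R t \<partial>lborel_pow (2*k))"
    by (simp add: sets_region)
  also have "\<dots> = (\<integral>\<^sup>+t. of_bool (region k s y t) \<partial>lborel_pow (2*k))"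
    by (intro nn_integral_cong) (auto simp: indicator_def)
  finally show ?thesis
    using assms by (simp add: nn_integral_region measure_def region_vol_def)
qed

lemma region_vol_1_1: "fact (2*k) * region_vol k 1 1 = catalan k * real (k + 2) * 2 powi (int k - 1)"
proof -
  have "region_vol k 1 1 = real (k + 2) * 2 powi (int k - 1) / (fact k * fact (Suc k))"
  \<comment> \<open>For \<open>k = 0\<close> the power of 2 is 1/2 and cancels against
    \<open>k + 2\<close>; otherwise
    \<open>2 ^ k + k * 2 ^ (k-1) = (k + 2) * 2 ^ (k-1)\<close>.\<close>
  proof (cases k)
    case (Suc m)
    then show ?thesis by (simp add: region_vol_def algebra_simps)
  qed (simp add: region_vol_def)
  moreover have "catalan k = fact (2*k) / (fact k * fact (Suc k))"
    by (simp add: catalan_def binomial_fact field_simps)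
  ultimately show ?thesis by simp
qed

section \<open>Coordinates on the flow space of the caracol graph\<close>

text \<open>The free coordinates are $t_{2i} = b_{(1,j)}$ and $t_{2i+1} = b_{(j,j+1)}$ for
  $j = k+1-i$, $0 \le i < k$, where $n = k+2$. The order is reversed so that \<^const>\<open>region\<close>, which
  removes the coordinates with the largest indices first, runs through the vertices upwards.
  The arc $(n,n+1)$ is treated as $(j,k+3)$ rather than as $(j,j+1)$.\<close>

definition flow_x :: "nat \<Rightarrow> (nat \<Rightarrow> int) \<Rightarrow> (nat \<Rightarrow> real) \<Rightarrow> nat \<Rightarrow> real" where
  "flow_x k a t j = (if j = k+2 then of_int (a 1) - (\<Sum>i<k. t (2*i)) else t (2*(k+1-j)))"

text \<open>The default 0 serves both ends: vertex 1 has no such coordinate, and the arc from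
  \<open>k+2\<close> to \<open>k+3\<close> is covered by \<open>flow_z\<close>.\<close>

definition flow_y :: "nat \<Rightarrow> (nat \<Rightarrow> real) \<Rightarrow> nat \<Rightarrow> real" where
  "flow_y k t j = (if 2 \<le> j \<and> j \<le> k+1 then t (2*(k+1-j)+1) else 0)"

text \<open>Conservation at \<open>j\<close> solved for the arc \<open>(j, k+3)\<close>, just as
  \<open>flow_x\<close> at \<open>k+2\<close> solves conservation at vertex 1.\<close>

definition flow_z :: "nat \<Rightarrow> (nat \<Rightarrow> int) \<Rightarrow> (nat \<Rightarrow> real) \<Rightarrow> nat \<Rightarrow> real" where
  "flow_z k a t j = of_int (a j) + flow_x k a t j + flow_y k t (j-1) - flow_y k t j"

definition flow_of :: "nat \<Rightarrow> (nat \<Rightarrow> int) \<Rightarrow> (nat \<Rightarrow> real) \<Rightarrow> nat \<times> nat \<Rightarrow> real" where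
  "flow_of k a t = (\<lambda>(u, v).
     if u = 1 \<and> 2 \<le> v \<and> v \<le> k+2 then flow_x k a t v
     else if 2 \<le> u \<and> u \<le> k+1 \<and> v = u+1 then flow_y k t u
     else if 2 \<le> u \<and> u \<le> k+2 \<and> v = k+3 then flow_z k a t u
     else 0)"

definition coords :: "nat \<Rightarrow> (nat \<times> nat \<Rightarrow> real) \<Rightarrow> nat \<Rightarrow> real" where
  "coords k b l = (if even l then b (1, k+1 - l div 2) else b (k+1 - l div 2, k+1 - l div 2 + 1))"

lemma coords_even: "coords k b (2*i) = b (1, k+1-i)"
  by (simp add: coords_def)

lemma coords_odd: "coords k b (Suc (2*i)) = b (k+1-i, Suc (k+1-i))"
  by (simp add: coords_def)

text \<open>The arc \<open>(k+2, k+3)\<close> is moved to the third family, which makes the cases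
  match those of \<open>flow_of\<close>.\<close>

lemma arcs_caracol: "(u, v) \<in> arcs (caracol (k+2)) \<longleftrightarrow>
    u = 1 \<and> 2 \<le> v \<and> v \<le> k+2 \<or> 2 \<le> u \<and> u \<le> k+1 \<and> v = u+1 \<or> 2 \<le> u \<and> u \<le> k+2 \<and> v = k+3"
  by (auto simp: caracol_def)

lemma netflow_caracol_1: "netflow (caracol (k+2)) b 1 = (\<Sum>j=2..k+2. b (1, j))"
proof -
  have "out_arcs (caracol (k+2)) 1 = Pair 1 ` {2..k+2}" "in_arcs (caracol (k+2)) 1 = {}"
    by (auto simp: out_arcs_def in_arcs_def caracol_def)
  then show ?thesis
    by (simp add: netflow_def sum.reindex inj_on_def)
qed

text \<open>The conditionals avoid counting an arc twice: at \<open>j = k+2\<close> the arc to the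
  successor is \<open>(j, k+3)\<close>, and at \<open>j = 2\<close> the arc from the predecessor is
  \<open>(1, j)\<close>.\<close>

lemma netflow_caracol:
  assumes "2 \<le> j" "j \<le> k+2"
  shows "netflow (caracol (k+2)) b j =
    (if j \<le> k+1 then b (j, j+1) else 0) + b (j, k+3) - b (1, j) - (if 3 \<le> j then b (j-1, j) else 0)"
proof -
  have "out_arcs (caracol (k+2)) j = (if j \<le> k+1 then {(j, j+1)} else {}) \<union> {(j, k+3)}"
    using assms by (auto simp: out_arcs_def caracol_def)
  moreover have "in_arcs (caracol (k+2)) j = {(1, j)} \<union> (if 3 \<le> j then {(j-1, j)} else {})"
    using assms by (auto simp: in_arcs_def caracol_def)
  ultimately show ?thesis
    using assms by (simp add: netflow_def)
qed

lemma sum_reflect: "(\<Sum>j=2..k+1. f (k+1-j)) = (\<Sum>i<k. f i)"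
  for f :: "nat \<Rightarrow> real"
  by (rule sum.reindex_bij_witness[of _ "\<lambda>i. k+1-i" "\<lambda>j. k+1-j"]) auto

lemma flow_of_in_flow_space: "flow_of k a t \<in> flow_space (caracol (k+2)) (k+2) a"
  unfolding flow_space_def
proof (intro CollectI conjI allI impI ballI)
  fix e :: "nat \<times> nat" assume "e \<notin> arcs (caracol (k+2))"
  then show "flow_of k a t e = 0"
    by (cases e, hypsubst, unfold arcs_caracol) (auto simp: flow_of_def)
next
  fix j assume j: "j \<in> {1..k+2}"
  show "netflow (caracol (k+2)) (flow_of k a t) j = of_int (a j)"
  proof (cases "j = 1")
    case True
    have "netflow (caracol (k+2)) (flow_of k a t) 1 = (\<Sum>j=2..k+2. flow_x k a t j)"
      unfolding netflow_caracol_1 by (intro sum.cong) (auto simp: flow_of_def)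
    also have "\<dots> = (\<Sum>j=2..k+1. t (2*(k+1-j))) + flow_x k a t (k+2)"
      by (simp add: flow_x_def)
    also have "\<dots> = of_int (a 1)"
      using sum_reflect[of "\<lambda>i. t (2*i)" k] by (simp add: flow_x_def)
    finally show ?thesis using True by simp
  next
    case False
    then show ?thesis
      using j by (subst netflow_caracol) (auto simp: flow_of_def flow_z_def flow_y_def)
  qed
qed

text \<open>Conservation determines the dependent arcs from the free ones. With
  \<open>coords_flow_of\<close> this identifies the flow space with the space of the
  \<open>2*k\<close> free coordinates.\<close>

lemma flow_of_coords:
  assumes "b \<in> flow_space (caracol (k+2)) (k+2) a"
  shows "flow_of k a (coords k b) = b"
proof -
  have zero: "b e = 0" if "e \<notin> arcs (caracol (k+2))" for e
    using assms that unfolding flow_space_def by blast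
  have nf: "netflow (caracol (k+2)) b j = of_int (a j)" if "1 \<le> j" "j \<le> k+2" for j
    using assms that by (auto simp: flow_space_def)
  have x: "flow_x k a (coords k b) j = b (1, j)" if "2 \<le> j" "j \<le> k+2" for j
  proof (cases "j = k+2")
    case True
    have "(\<Sum>i<k. coords k b (2*i)) = (\<Sum>j=2..k+1. b (1, j))"
      by (subst sum_reflect[symmetric]) (auto intro!: sum.cong simp: coords_def)
    moreover have "(\<Sum>j=2..k+1. b (1, j)) + b (1, k+2) = of_int (a 1)"
      using nf[of 1] unfolding netflow_caracol_1 by simp
    ultimately show ?thesis using True by (simp add: flow_x_def)
  qed (use that in \<open>auto simp: flow_x_def coords_def\<close>)
  have y: "flow_y k (coords k b) j = b (j, j+1)" if "2 \<le> j" "j \<le> k+1" for j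
    using that by (simp add: flow_y_def coords_odd)
  have z: "flow_z k a (coords k b) j = b (j, k+3)" if j: "2 \<le> j" "j \<le> k+2" for j
  proof -
    have "(if j \<le> k+1 then b (j, j+1) else 0) = flow_y k (coords k b) j"
      using j by (auto simp: coords_odd flow_y_def)
    moreover have "(if 3 \<le> j then b (j-1, j) else 0) = flow_y k (coords k b) (j-1)"
      using j y[of "j-1"] by (auto simp: flow_y_def)
    moreover have "netflow (caracol (k+2)) b j = of_int (a j)"
      using nf j by auto
    ultimately show ?thesis
      using netflow_caracol[OF j, of b] x[OF j] unfolding flow_z_def by linarith
  qed
  show ?thesis
  proof
    fix e :: "nat \<times> nat"
    obtain u v where e: "e = (u, v)" by (cases e)
    show "flow_of k a (coords k b) e = b e"
    proof (cases "(u, v) \<in> arcs (caracol (k+2))")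
      case True
      then show ?thesis unfolding e arcs_caracol flow_of_def by (auto simp: x y z)
    next
      case False
      then show ?thesis using zero[OF False] unfolding e arcs_caracol flow_of_def by auto
    qed
  qed
qed

lemma coords_flow_of:
  assumes "l < 2*k"
  shows "coords k (flow_of k a t) l = t l"
proof (cases "even l")
  case True
  then obtain i where l: "l = 2*i" by (rule evenE)
  with assms have "2 \<le> k+1-i" "k+1-i \<le> k+1" "k+1-(k+1-i) = i" by auto
  then show ?thesis unfolding l coords_even flow_of_def flow_x_def by auto
next
  case False
  then obtain i where l: "l = Suc (2*i)" by (auto elim: oddE)
  with assms have "2 \<le> k+1-i" "k+1-i \<le> k+1" "k+1-(k+1-i) = i" by auto
  then show ?thesis unfolding l coords_odd flow_of_def flow_y_def by auto
qed

lemma flow_of_cong: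
  assumes "\<And>i. i < 2*k \<Longrightarrow> t i = t' i"
  shows "flow_of k a t = flow_of k a t'"
proof -
  have "(\<Sum>i<k. t (2*i)) = (\<Sum>i<k. t' (2*i))"
    using assms by (intro sum.cong) auto
  \<comment> \<open>The range of \<open>j\<close> matters: below 2, \<open>flow_x\<close> would read
    \<open>t\<close> at an index of at least \<open>2*k\<close>.\<close>
  then have x: "flow_x k a t j = flow_x k a t' j" if "2 \<le> j" "j \<le> k+2" for j
    using that assms by (auto simp: flow_x_def)
  have "flow_y k t j = flow_y k t' j" for j
    using assms by (auto simp: flow_y_def)
  with x have "flow_of k a t (u, v) = flow_of k a t' (u, v)" for u v
    by (simp add: flow_of_def flow_z_def)
  then show ?thesis by (simp add: fun_eq_iff)
qed

section \<open>Linearity, integrality and the lattice basis\<close>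

lemma flow_of_add: "flow_of k (\<lambda>i. a i + b i) (\<lambda>i. s i + t i) e = flow_of k a s e + flow_of k b t e"
proof -
  have x: "flow_x k (\<lambda>i. a i + b i) (\<lambda>i. s i + t i) j = flow_x k a s j + flow_x k b t j" for j
    by (simp add: flow_x_def sum.distrib)
  have y: "flow_y k (\<lambda>i. s i + t i) j = flow_y k s j + flow_y k t j" for j
    by (simp add: flow_y_def)
  have "flow_z k (\<lambda>i. a i + b i) (\<lambda>i. s i + t i) j = flow_z k a s j + flow_z k b t j" for j
    by (simp add: flow_z_def x y)
  with x y show ?thesis
    by (cases e) (simp only: flow_of_def prod.case, simp)
qed

lemma flow_of_scale: "flow_of k (\<lambda>_. 0) (\<lambda>i. c * t i) e = c * flow_of k (\<lambda>_. 0) t e"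
proof -
  have x: "flow_x k (\<lambda>_. 0) (\<lambda>i. c * t i) j = c * flow_x k (\<lambda>_. 0) t j" for j
    by (simp add: flow_x_def sum_distrib_left)
  have y: "flow_y k (\<lambda>i. c * t i) j = c * flow_y k t j" for j
    by (simp add: flow_y_def)
  have "flow_z k (\<lambda>_. 0) (\<lambda>i. c * t i) j = c * flow_z k (\<lambda>_. 0) t j" for j
    by (simp add: flow_z_def x y algebra_simps)
  with x y show ?thesis
    by (cases e) (simp only: flow_of_def prod.case, simp)
qed

text \<open>Solving for the dependent arcs uses only sums and differences, so no denominators
  arise.\<close>

lemma flow_of_Ints:
  assumes "\<And>i. i < 2*k \<Longrightarrow> t i \<in> \<int>"
  shows "flow_of k a t e \<in> \<int>"
proof -
  have "(\<Sum>i<k. t (2*i)) \<in> \<int>" using assms by (intro Ints_sum) auto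
  then have x: "flow_x k a t j \<in> \<int>" if "2 \<le> j" "j \<le> k+2" for j
    using that assms by (auto simp: flow_x_def)
  have "flow_y k t j \<in> \<int>" for j
    using assms by (auto simp: flow_y_def)
  with x show ?thesis
    by (auto simp: flow_of_def flow_z_def split: prod.split)
qed

definition flow_basis :: "nat \<Rightarrow> nat \<Rightarrow> nat \<times> nat \<Rightarrow> real" where
  "flow_basis k i = flow_of k (\<lambda>_. 0) (\<lambda>j. if j = i then 1 else 0)"

lemma flow_of_eq_sum_basis: "flow_of k (\<lambda>_. 0) t e = (\<Sum>i<2*k. t i * flow_basis k i e)"
proof -
  \<comment> \<open>Truncation after \<open>m\<close> coordinates allows additivity to be applied to
    one coordinate at a time.\<close>
  have "flow_of k (\<lambda>_. 0) (\<lambda>j. if j < m then t j else 0) e = (\<Sum>i<m. t i * flow_basis k i e)" for m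
  proof (induction m)
    case 0
    show ?case using flow_of_scale[of k 0 "\<lambda>_. 0" e] by simp
  next
    case (Suc m)
    have "(\<lambda>j. if j < Suc m then t j else 0)
        = (\<lambda>j. (if j < m then t j else 0) + t m * (if j = m then 1 else 0))"
      by (auto simp: fun_eq_iff less_Suc_eq)
    then show ?case
      using flow_of_add[of k "\<lambda>_. 0" "\<lambda>_. 0" "\<lambda>j. if j < m then t j else 0" "\<lambda>j. t m * (if j = m then 1 else 0)" e]
      by (simp add: Suc.IH flow_of_scale flow_basis_def)
  qed
  from this[of "2*k"] show ?thesis
    using flow_of_cong[of k t "\<lambda>j. if j < 2*k then t j else 0"] by simp
qed

text \<open>Independence holds because \<open>coords\<close> recovers the coefficients; the basis
  generates the lattice because \<open>coords\<close> and \<open>flow_of\<close> both preserve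
  integrality.\<close>

lemma lattice_basis_flow_basis: "lattice_basis (2*k) (flow_basis k) (flow_lattice (caracol (k+2)) (k+2))"
  unfolding lattice_basis_def flow_of_eq_sum_basis[symmetric]
proof (intro conjI allI impI)
  fix t :: "nat \<Rightarrow> real" and i
  assume "\<forall>e. flow_of k (\<lambda>_. 0) t e = 0" and i: "i < 2*k"
  then have "coords k (flow_of k (\<lambda>_. 0) t) i = 0" by (simp add: coords_def)
  then show "t i = 0" using i by (simp add: coords_flow_of)
next
  show "flow_lattice (caracol (k+2)) (k+2) = {\<lambda>e. flow_of k (\<lambda>_. 0) (\<lambda>i. of_int (c i)) e |c. True}"
  proof (intro equalityI subsetI)
    fix b assume b: "b \<in> flow_lattice (caracol (k+2)) (k+2)"
    then have "\<forall>i. coords k b i \<in> \<int>" by (auto simp: flow_lattice_def coords_def)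
    then have "\<forall>i. \<exists>c. coords k b i = of_int c" by (auto elim!: Ints_cases)
    from choice[OF this] obtain c where "\<forall>i. coords k b i = of_int (c i)" ..
    then have "coords k b = (\<lambda>i. of_int (c i))" by auto
    then have "flow_of k (\<lambda>_. 0) (\<lambda>i. of_int (c i)) = b"
      using flow_of_coords[of b k "\<lambda>_. 0"] b by (simp add: flow_lattice_def)
    then show "b \<in> {\<lambda>e. flow_of k (\<lambda>_. 0) (\<lambda>i. of_int (c i)) e |c. True}" by auto
  next
    fix b assume "b \<in> {\<lambda>e. flow_of k (\<lambda>_. 0) (\<lambda>i. of_int (c i)) e |c :: nat \<Rightarrow> int. True}"
    then show "b \<in> flow_lattice (caracol (k+2)) (k+2)"
      unfolding flow_lattice_def using flow_of_in_flow_space[of k "\<lambda>_. 0"]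
      by (auto intro: flow_of_Ints)
  qed
qed

section \<open>The inequalities of the polytope and its volume\<close>

lemma region_iff:
  assumes "0 \<le> s"
  shows "region k s y t \<longleftrightarrow> (\<forall>i<k. 0 \<le> t (2*i)) \<and> (\<Sum>i<k. t (2*i)) \<le> s \<and>
    (\<forall>i<k. 0 \<le> t (2*i+1) \<and> t (2*i+1) \<le> t (2*i) + (if Suc i = k then y else t (2*i+3)))"
  using assms
proof (induction k arbitrary: s y)
  case (Suc k)
  \<comment> \<open>The recursion bounds each even coordinate by what remains of \<open>s\<close>;
    with nonnegativity this follows from the bound on the full sum.\<close>
  have s: "t (2*k) \<le> s" if "\<forall>i<Suc k. 0 \<le> t (2*i)" "(\<Sum>i<Suc k. t (2*i)) \<le> s"
    using that sum_nonneg[of "{..<k}" "\<lambda>i. t (2*i)"] by auto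
  \<comment> \<open>For the shorter region the bound at the top index is \<open>t (2*k+1)\<close>,
    which is \<open>t (2*i+3)\<close> when \<open>Suc i = k\<close>.\<close>
  have y: "(\<forall>i<k. 0 \<le> t (2*i+1) \<and> t (2*i+1) \<le> t (2*i) + (if Suc i = k then t (2*k+1) else t (2*i+3)))
    \<longleftrightarrow> (\<forall>i<k. 0 \<le> t (2*i+1) \<and> t (2*i+1) \<le> t (2*i) + (if Suc i = Suc k then y else t (2*i+3)))"
    by (intro all_cong) (auto simp: numeral_3_eq_3)
  show ?case
  proof (cases "0 \<le> t (2*k) \<and> t (2*k) \<le> s")
    case True
    then have "region k (s - t (2*k)) (t (2*k+1)) t \<longleftrightarrow> (\<forall>i<k. 0 \<le> t (2*i)) \<and> (\<Sum>i<k. t (2*i)) \<le> s - t (2*k) \<and>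
      (\<forall>i<k. 0 \<le> t (2*i+1) \<and> t (2*i+1) \<le> t (2*i) + (if Suc i = Suc k then y else t (2*i+3)))"
      by (subst Suc.IH) (simp_all only: y, simp)
    then show ?thesis using True unfolding region.simps All_less_Suc by auto
  next
    case False
    then show ?thesis using s by (auto simp: All_less_Suc)
  qed
qed simp

lemma flow_of_in_flow_polytope_iff:
  "flow_of k (\<lambda>j. if j \<in> {1, 2} then 1 else 0) t \<in>
     flow_polytope (caracol (k+2)) (k+2) (\<lambda>j. if j \<in> {1, 2} then 1 else 0) \<longleftrightarrow> region k 1 1 t"
proof -
  define a :: "nat \<Rightarrow> int" where "a = (\<lambda>j. if j \<in> {1, 2} then 1 else 0)"
  have all: "(\<forall>j. 2 \<le> j \<and> j \<le> k+1 \<longrightarrow> P j) \<longleftrightarrow> (\<forall>i<k. P (k+1-i))" for P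
  proof safe
    fix j assume P: "\<forall>i<k. P (k+1-i)" and j: "2 \<le> j" "j \<le> k+1"
    then show "P j" using P[rule_format, of "k+1-j"] by simp
  qed auto
  have top: "(\<forall>j. 2 \<le> j \<and> j \<le> k+2 \<longrightarrow> P j) \<longleftrightarrow> (\<forall>i<k. P (k+1-i)) \<and> P (k+2)" for P
  proof -
    have "2 \<le> j \<and> j \<le> k+2 \<longleftrightarrow> 2 \<le> j \<and> j \<le> k+1 \<or> j = k+2" for j by auto
    then show ?thesis unfolding all[symmetric] by blast
  qed
  have "flow_of k a t \<in> flow_polytope (caracol (k+2)) (k+2) a \<longleftrightarrow>
     (\<forall>u v. (u, v) \<in> arcs (caracol (k+2)) \<longrightarrow> 0 \<le> flow_of k a t (u, v))"
    using flow_of_in_flow_space[of k a t] unfolding flow_polytope_def by auto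
  also have "\<dots> \<longleftrightarrow> (\<forall>j. 2 \<le> j \<and> j \<le> k+2 \<longrightarrow> 0 \<le> flow_x k a t j) \<and>
      (\<forall>j. 2 \<le> j \<and> j \<le> k+1 \<longrightarrow> 0 \<le> flow_y k t j) \<and>
      (\<forall>j. 2 \<le> j \<and> j \<le> k+2 \<longrightarrow> 0 \<le> flow_z k a t j)"
    unfolding arcs_caracol flow_of_def by auto
  also have "\<dots> \<longleftrightarrow> (\<forall>i<k. 0 \<le> t (2*i)) \<and> 0 \<le> flow_x k a t (k+2) \<and> (\<forall>i<k. 0 \<le> t (2*i+1)) \<and>
      (\<forall>i<k. 0 \<le> flow_z k a t (k+1-i)) \<and> 0 \<le> flow_z k a t (k+2)"
    unfolding top all by (auto simp: flow_x_def flow_y_def)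
  also have "\<dots> \<longleftrightarrow> (\<forall>i<k. 0 \<le> t (2*i)) \<and> 0 \<le> flow_x k a t (k+2) \<and> (\<forall>i<k. 0 \<le> t (2*i+1)) \<and>
      (\<forall>i<k. 0 \<le> flow_z k a t (k+1-i))"
  \<comment> \<open>At the last inner vertex \<open>flow_z\<close> is a sum of nonnegative terms, as
    no further \<open>flow_y\<close> is subtracted.\<close>
  proof -
    have "0 \<le> flow_z k a t (k+2)" if "0 \<le> flow_x k a t (k+2)" "\<forall>i<k. 0 \<le> t (2*i+1)"
      using that by (auto simp: flow_z_def flow_y_def a_def)
    then show ?thesis by blast
  qed
  also have "\<dots> \<longleftrightarrow> region k 1 1 t"
  proof -
    \<comment> \<open>\<open>Suc i = k\<close> is vertex 2, where the netflow 1 takes the place of a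
      preceding odd coordinate; at later vertices up to \<open>k+1\<close> the netflow is 0.\<close>
    have "0 \<le> flow_z k a t (k+1-i) \<longleftrightarrow> t (2*i+1) \<le> t (2*i) + (if Suc i = k then 1 else t (2*i+3))"
      if "i < k" for i
    proof (cases "Suc i = k")
      case False
      then have "k + 1 - (k + 1 - i - 1) = Suc i" "k + 1 - (k + 1 - i) = i" using that by auto
      with that False show ?thesis by (auto simp: flow_z_def flow_x_def flow_y_def a_def numeral_3_eq_3)
    qed (auto simp: flow_z_def flow_x_def flow_y_def a_def)
    moreover have "0 \<le> flow_x k a t (k+2) \<longleftrightarrow> (\<Sum>i<k. t (2*i)) \<le> 1"
      by (simp add: flow_x_def a_def)
    ultimately show ?thesis by (subst region_iff) auto
  qed
  finally show ?thesis unfolding a_def .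
qed

theorem proposition6p9:
  fixes n :: nat
  assumes "n \<ge> 2"
  shows "flow_polytope_volume (caracol n) n (\<lambda>j. if j \<in> {1, 2} then 1 else 0)
         = catalan (n - 2) * real n * 2 powi (int n - 3)"
proof -
  obtain k where n: "n = k + 2"
    using assms by (metis add.commute le_Suc_ex)
  let ?a = "\<lambda>j :: nat. if j \<in> {1, 2} then 1 else 0 :: int" and ?G = "caracol (k+2)"
  \<comment> \<open>The base point is the flow whose free coordinates all vanish.\<close>
  have flow: "(\<lambda>e. flow_of k ?a (\<lambda>_. 0) e + (\<Sum>i<2*k. t i * flow_basis k i e)) = flow_of k ?a t" for t
    using flow_of_add[of k ?a "\<lambda>_. 0" "\<lambda>_. 0" t] by (simp add: flow_of_eq_sum_basis fun_eq_iff)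
  have "lattice_volume (2*k) (flow_lattice ?G (k+2)) (flow_space ?G (k+2) ?a) (flow_polytope ?G (k+2) ?a)
    = measure (lborel_pow (2*k)) {t \<in> space (lborel_pow (2*k)).
        (\<lambda>e. flow_of k ?a (\<lambda>_. 0) e + (\<Sum>i<2*k. t i * flow_basis k i e)) \<in> flow_polytope ?G (k+2) ?a}"
  proof (rule lattice_volume_eq[OF lattice_basis_flow_basis flow_of_in_flow_space])
    fix q assume "q \<in> flow_space ?G (k+2) ?a"
    then show "\<exists>t. q = (\<lambda>e. flow_of k ?a (\<lambda>_. 0) e + (\<Sum>i<2*k. t i * flow_basis k i e))"
      unfolding flow by (metis flow_of_coords)
  next
    show "{t \<in> space (lborel_pow (2*k)). (\<lambda>e. flow_of k ?a (\<lambda>_. 0) e + (\<Sum>i<2*k. t i * flow_basis k i e))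
        \<in> flow_polytope ?G (k+2) ?a} \<in> sets (lborel_pow (2*k))"
      unfolding flow flow_of_in_flow_polytope_iff by (rule sets_region) simp
  qed
  also have "\<dots> = region_vol k 1 1"
    unfolding flow flow_of_in_flow_polytope_iff by (rule measure_region) simp_all
  finally have "lattice_volume (2*k) (flow_lattice ?G (k+2)) (flow_space ?G (k+2) ?a) (flow_polytope ?G (k+2) ?a)
    = region_vol k 1 1" .
  \<comment> \<open>The dimension is \<open>(3*n - 4) - n\<close> with
    \<open>n = k+2\<close>.\<close>
  moreover have "card (arcs ?G) - (k+2) = 2*k"
    by (subst card_arcs_caracol) auto
  ultimately have "flow_polytope_volume ?G (k+2) ?a = fact (2*k) * region_vol k 1 1"
    unfolding flow_polytope_volume_def Let_def by simp
  then show ?thesis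
    by (simp add: n region_vol_1_1)
qed

end
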